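(* Let $d \ge 0$ and $p \ge 1$ be integers and let $h \in S_1$. Then $h$ is a vertex of the polytope $S_1$ if and only if all of the following hold: (1) $\max(h) = 1$, i.e. the largest entry of $h$ equals $1$; (2) for each $r \in \{0,\dots,p-1\}$, at most two of the entries $h_{r,0}, h_{r,1}, \dots, h_{r,d}$ are nonzero; and (3) $CM_r(h) \in \mathbb{Z}$ for all $r \in \{0,\dots,p-1\}$.
   Context: A vector $h \in \mathbb{R}^{p(d+1)}$ is indexed as $h = (h_0, h_1, \dots, h_{p(d+1)-1})$, and we write $h_{r,j} := h_{jp+r}$ for $0 \le r \le p-1$ and $0 \le j \le d$; the entries $h_{r,0},\dots,h_{r,d}$ form the $r$-th mod class of $h$. Put $h(z) := \sum_i h_i z^i$ and define $L_h : \mathbb{Z}_{\ge 0} \to \mathbb{R}$ by $\sum_{n \ge 0} L_h(n) z^n := h(z)/(1-z^p)^{d+1}$; equivalently, $L_h(tp+r) = \sum_{j=0}^d h_{r,j}\binom{t+d-j}{d}$ for $t \ge 0$, $0 \le r \le p-1$. For $N \in \mathbb{Z}_{\ge 0}$, let $C_N := \{h \in \mathbb{R}^{p(d+1)} : L_h(n+1) \ge L_h(n) \text{ for all integers } n \ge N\}$, let $C_{\mathrm{END}} := \bigcup_{N \ge 0} C_N$, and let $\overline{C_{\mathrm{END}}}$ be its topological closure. Define the rational polytope $$S_1 := \overline{C_{\mathrm{END}}} \cap \Big\{h \in \mathbb{R}_{\ge 0}^{p(d+1)} : \sum_{j=0}^d h_{0,j} = 1\Big\}.$$ (Every $h\in\overline{C_{\mathrm{END}}}$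 has $\sum_{j} h_{r,j}$ independent of $r$, so for $h \in S_1$ all these sums equal $1$.) For $h \in S_1$ the center-of-mass of the $r$-th mod class is $CM_r(h) := \sum_{j=0}^d j\,h_{r,j}$. *)

theory Defs
  imports "HOL-Analysis.Analysis" "HOL-Computational_Algebra.Formal_Power_Series"
begin

unbundle no fps_syntax
unbundle vec_syntax

text \<open>
  Vectors with \<open>p * (d + 1)\<close> entries are elements of \<open>real ^ 'n\<close>, where the enumeration
  \<open>e\<close> of the coordinates is a bijection from \<open>{..<p * (d + 1)}\<close> onto \<open>UNIV :: 'n set\<close>.
  The entry of \<open>h\<close> with number \<open>i\<close> is thus \<open>h $ e i\<close>, and so \<open>CARD('n) = p * (d + 1)\<close>.
\<close>

definition mod_entry :: "(nat \<Rightarrow> 'n::finite) \<Rightarrow> nat \<Rightarrow> real ^ 'n \<Rightarrow> nat \<Rightarrow> nat \<Rightarrow> real" where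
  "mod_entry e p h r j = h $ e (j * p + r)"

definition h_series :: "(nat \<Rightarrow> 'n::finite) \<Rightarrow> nat \<Rightarrow> nat \<Rightarrow> real ^ 'n \<Rightarrow> real fps" where
  "h_series e p d h = (\<Sum>i<p * (d + 1). fps_const (h $ e i) * fps_X ^ i)"

definition L :: "(nat \<Rightarrow> 'n::finite) \<Rightarrow> nat \<Rightarrow> nat \<Rightarrow> real ^ 'n \<Rightarrow> nat \<Rightarrow> real" where
  "L e p d h n = fps_nth (h_series e p d h / (1 - fps_X ^ p) ^ (d + 1)) n"

definition C :: "(nat \<Rightarrow> 'n::finite) \<Rightarrow> nat \<Rightarrow> nat \<Rightarrow> nat \<Rightarrow> (real ^ 'n) set" where
  "C e p d N = {h. \<forall>n\<ge>N. L e p d h (n + 1) \<ge> L e p d h n}"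

definition C_END :: "(nat \<Rightarrow> 'n::finite) \<Rightarrow> nat \<Rightarrow> nat \<Rightarrow> (real ^ 'n) set" where
  "C_END e p d = (\<Union>N. C e p d N)"

definition S1 :: "(nat \<Rightarrow> 'n::finite) \<Rightarrow> nat \<Rightarrow> nat \<Rightarrow> (real ^ 'n) set" where
  "S1 e p d = closure (C_END e p d) \<inter>
     {h. (\<forall>i. h $ i \<ge> 0) \<and> (\<Sum>j=0..d. mod_entry e p h 0 j) = 1}"

definition CM :: "(nat \<Rightarrow> 'n::finite) \<Rightarrow> nat \<Rightarrow> nat \<Rightarrow> real ^ 'n \<Rightarrow> nat \<Rightarrow> real" where
  "CM e p d h r = (\<Sum>j=0..d. real j * mod_entry e p h r j)"

end

(*
  Comparing the two leading coefficients of the polynomials t |-> L h (t p + r) shows that S_1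
  consists of the nonnegative h whose class sums are 1 and whose centers of mass satisfy
  CM_0 >= CM_1 >= ... >= CM_(p-1) >= CM_0 - 1. If these numbers are integers, all but one of the p
  inequalities are tight, so within the smallest face containing h all centers of mass move
  together; an entry 1 fixes one of them, and a class supported on two entries is determined by
  its sum and its center of mass. Conversely, a class with three nonzero entries can be perturbed
  without changing its sum and center of mass, and the classes whose centers of mass are congruent
  modulo 1 can be moved together unless one of them consists of a single entry 1.
*)
theory Submission
  imports Defs
begin

section \<open>Growth of binomial coefficients and the inverted denominator\<close>

text \<open>Induction on \<open>m\<close>: passing from \<open>m\<close> to \<open>Suc m\<close>
  multiplies the binomial coefficient by \<open>(t + c - m) / Suc m\<close>.\<close>

lemma binomial_over_power_tendsto:
  "(\<lambda>t. real ((t + c) choose m) / real t ^ m) \<longlonglongrightarrow> 1 / fact m"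
proof (induction m)
  case 0
  show ?case by simp
next
  case (Suc m)
  have lim: "(\<lambda>t. (real t + (real c - real m)) / real t / real (Suc m)) \<longlonglongrightarrow> 1 / real (Suc m)"
  proof (rule tendsto_divide)
    have "(\<lambda>t. 1 + (real c - real m) / real t) \<longlonglongrightarrow> 1 + 0"
      by (intro tendsto_intros tendsto_divide_0[OF tendsto_const] filterlim_at_top_imp_at_infinity
          filterlim_real_sequentially)
    moreover have "\<forall>\<^sub>F t in sequentially. 1 + (real c - real m) / real t
        = (real t + (real c - real m)) / real t"
      using eventually_gt_at_top[of 0] by eventually_elim (simp add: field_simps)
    ultimately show "(\<lambda>t. (real t + (real c - real m)) / real t) \<longlonglongrightarrow> 1"
      by (simp add: Lim_transform_eventually)
  qed auto
  have eq: "real ((t + c) choose m) / real t ^ m * ((real t + (real c - real m)) / real t / real (Suc m))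
      = real ((t + c) choose Suc m) / real t ^ Suc m" for t
  proof -
    have "real ((t + c) choose Suc m) * real (Suc m) =
        real ((t + c) choose m) * (real t + (real c - real m))"
    proof -
      \<comment> \<open>The generalized binomial coefficient gives this factor as a real difference,
        correct also for \<open>t + c < m\<close>.\<close>
      have "real (Suc m) * (real (t + c) gchoose Suc m) = (real (t + c) - real m) * (real (t + c) gchoose m)"
        by (simp only: gbinomial_absorption gbinomial_absorb_comp)
      then show ?thesis by (simp add: binomial_gbinomial mult.commute add_diff_eq)
    qed
    then have "real ((t + c) choose Suc m) =
        real ((t + c) choose m) * (real t + (real c - real m)) / real (Suc m)"
      by (simp only: eq_divide_eq) simp
    then show ?thesis by (simp only:) (simp add: ac_simps)
  qed
  show ?case
    using tendsto_mult[OF Suc lim] unfolding eq by (simp add: mult.commute)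
qed

text \<open>By Pascal's rule each unit of shift adds one \<open>(t + c) choose m\<close>, of size
  about \<open>t ^ m / fact m\<close>. This yields the second coefficient of \<open>L\<close> on a
  class.\<close>

lemma binomial_shift_over_power_tendsto:
  "(\<lambda>t. (real ((t + c) choose Suc m) - real (t choose Suc m)) / real t ^ m)
    \<longlonglongrightarrow> real c / fact m"
proof (induction c)
  case 0
  show ?case by simp
next
  case (Suc c)
  have "(\<lambda>t. (real ((t + c) choose Suc m) - real (t choose Suc m)) / real t ^ m
      + real ((t + c) choose m) / real t ^ m) \<longlonglongrightarrow> real c / fact m + 1 / fact m"
    by (intro tendsto_add Suc binomial_over_power_tendsto)
  then show ?case by (simp add: add_divide_distrib diff_divide_distrib algebra_simps)
qed

text \<open>The fps denominator is inverted one factor at a time, by Pascal's rule.\<close>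

lemma inverse_one_minus_X_power:
  fixes p d :: nat
  assumes "p \<ge> 1"
  shows "inverse ((1 - fps_X ^ p) ^ (d + 1) :: real fps) =
    Abs_fps (\<lambda>n. if p dvd n then real ((n div p + d) choose d) else 0)"
proof -
  define G where
    "G = (\<lambda>d. Abs_fps (\<lambda>n. if p dvd n then real ((n div p + d) choose d) else 0))"
  have step: "(1 - fps_X ^ p) * G (Suc d) = G d" for d
  proof (rule fps_ext)
    fix n
    have "fps_nth ((1 - fps_X ^ p) * G (Suc d)) n =
        fps_nth (G (Suc d)) n - (if n < p then 0 else fps_nth (G (Suc d)) (n - p))"
      by (simp add: left_diff_distrib fps_X_power_mult_nth)
    also have "\<dots> = fps_nth (G d) n"
    proof (cases "p dvd n")
      case True
      then obtain k where k: "n = p * k" by blast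
      show ?thesis using assms
        by (cases k) (auto simp: G_def k)
    next
      case False
      then have "\<not> p dvd (n - p)" if "\<not> n < p"
        using that by (auto simp: dvd_minus_self)
      then show ?thesis using False by (simp add: G_def)
    qed
    finally show "fps_nth ((1 - fps_X ^ p) * G (Suc d)) n = fps_nth (G d) n" .
  qed
  have base: "(1 - fps_X ^ p) * G 0 = 1"
  proof (rule fps_ext)
    fix n
    have "\<not> n < p \<Longrightarrow> p dvd (n - p) \<longleftrightarrow> p dvd n" by (simp add: dvd_minus_self)
    then show "fps_nth ((1 - fps_X ^ p) * G 0) n = fps_nth 1 n"
      using assms by (auto simp: left_diff_distrib fps_X_power_mult_nth G_def dest: dvd_imp_le)
  qed
  have "(1 - fps_X ^ p) ^ (d + 1) * G d = 1"
  proof (induction d)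
    case 0
    then show ?case using base by simp
  next
    case (Suc d)
    have "(1 - fps_X ^ p) ^ (Suc d + 1) * G (Suc d)
        = (1 - fps_X ^ p) ^ (d + 1) * ((1 - fps_X ^ p) * G (Suc d))"
      by (simp only: add_Suc power_Suc2 mult.assoc)
    then show ?case using Suc by (simp only: step)
  qed
  then have "G d = inverse ((1 - fps_X ^ p) ^ (d + 1))"
    by (simp add: fps_inverse_unique)
  then show ?thesis by (simp add: G_def)
qed

section \<open>Two elementary facts for the vertex arguments\<close>

text \<open>On two positions the moments of order 0 and 1 form an invertible Vandermonde system.
  Hence a class with such a support is determined by its sum and center of mass.\<close>

lemma weights_eq_0_if_two_moments_eq_0:
  fixes w :: "nat \<Rightarrow> real"
  assumes "finite A" "card A \<le> 2" "sum w A = 0" "(\<Sum>j\<in>A. real j * w j) = 0" "j \<in> A"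
  shows "w j = 0"
proof -
  consider "card A = 0" | "card A = 1" | "card A = 2" using assms(2) by linarith
  then show ?thesis
  proof cases
    case 1
    then show ?thesis using assms by simp
  next
    case 2
    then show ?thesis using assms by (auto simp: card_1_singleton_iff)
  next
    case 3
    then obtain a b where A: "A = {a, b}" "a \<noteq> b" by (auto simp: card_2_iff)
    then have w: "w b = - w a" and m: "real a * w a + real b * w b = 0" using assms by auto
    have "(real a - real b) * w a = 0" using m unfolding w by (simp add: algebra_simps)
    then have "w a = 0" using A by simp
    then show ?thesis using w assms(5) A by auto
  qed
qed

text \<open>A positive value stays positive nearby, and a zero value does not move. The filter
  \<open>nhds 0\<close> covers both signs of \<open>\<delta>\<close>, so motion is possible in both
  directions.\<close>

lemma eventually_nonneg_perturbation:
  fixes c w :: real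
  assumes "c \<ge> 0" "c = 0 \<Longrightarrow> w = 0"
  shows "\<forall>\<^sub>F \<delta> in nhds 0. c + \<delta> * w \<ge> 0"
proof (cases "c = 0")
  case True
  then show ?thesis using assms by simp
next
  case False
  have "((\<lambda>\<delta>. c + \<delta> * w) \<longlongrightarrow> c + 0 * w) (nhds 0)"
    by (intro tendsto_intros filterlim_ident)
  then have "\<forall>\<^sub>F \<delta> in nhds 0. c + \<delta> * w > 0"
    using False assms(1) by (intro order_tendstoD(1)) auto
  then show ?thesis by eventually_elim simp
qed

section \<open>Class sums, centers of mass and gaps as linear functionals\<close>

definition class_sum :: "(nat \<Rightarrow> 'n::finite) \<Rightarrow> nat \<Rightarrow> nat \<Rightarrow> real ^ 'n \<Rightarrow> nat \<Rightarrow> real" where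
  "class_sum e p d h r = (\<Sum>j=0..d. mod_entry e p h r j)"

text \<open>Up to the factor \<open>1 / (d - 1)!\<close>, the coefficient of \<open>t ^ (d - 1)\<close> in
  \<open>L h (t p + r + 1) - L h (t p + r)\<close> when all class sums agree. The last term accounts for
  the step from class \<open>p - 1\<close> at \<open>t\<close> to class \<open>0\<close> at \<open>t + 1\<close>.\<close>

definition gap :: "(nat \<Rightarrow> 'n::finite) \<Rightarrow> nat \<Rightarrow> nat \<Rightarrow> real ^ 'n \<Rightarrow> nat \<Rightarrow> real" where
  "gap e p d h r = CM e p d h r - CM e p d h (Suc r mod p)
    + of_bool (Suc r = p) * class_sum e p d h 0"

lemma mod_entry_linear [simp]:
  "mod_entry e p (g + h) r j = mod_entry e p g r j + mod_entry e p h r j"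
  "mod_entry e p (g - h) r j = mod_entry e p g r j - mod_entry e p h r j"
  "mod_entry e p (c *\<^sub>R h) r j = c * mod_entry e p h r j"
  by (simp_all add: mod_entry_def)

lemma class_sum_linear [simp]:
  "class_sum e p d (g + h) r = class_sum e p d g r + class_sum e p d h r"
  "class_sum e p d (g - h) r = class_sum e p d g r - class_sum e p d h r"
  "class_sum e p d (c *\<^sub>R h) r = c * class_sum e p d h r"
  by (simp_all add: class_sum_def sum.distrib sum_subtractf sum_distrib_left)

lemma CM_linear [simp]:
  "CM e p d (g + h) r = CM e p d g r + CM e p d h r"
  "CM e p d (g - h) r = CM e p d g r - CM e p d h r"
  "CM e p d (c *\<^sub>R h) r = c * CM e p d h r"
  by (simp_all add: CM_def sum.distrib sum_subtractf sum_distrib_left algebra_simps)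

lemma gap_linear [simp]:
  "gap e p d (g + h) r = gap e p d g r + gap e p d h r"
  "gap e p d (g - h) r = gap e p d g r - gap e p d h r"
  "gap e p d (c *\<^sub>R h) r = c * gap e p d h r"
  by (simp_all add: gap_def algebra_simps)

lemma continuous_on_class_sum: "continuous_on UNIV (\<lambda>h. class_sum e p d h r)"
  unfolding class_sum_def mod_entry_def by (intro continuous_intros)

lemma continuous_on_gap: "continuous_on UNIV (\<lambda>h. gap e p d h r)"
  unfolding gap_def class_sum_def CM_def mod_entry_def by (intro continuous_intros)

section \<open>Coordinates arranged by mod class\<close>

locale mod_classes =
  fixes p d :: nat and e :: "nat \<Rightarrow> 'n::finite"
  assumes p_pos: "p \<ge> 1" and bij_e: "bij_betw e {..<p * (d + 1)} UNIV"
begin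

lemma index_less:
  assumes "r < p" "j \<le> d"
  shows "j * p + r < p * (d + 1)"
proof -
  have "j * p + r < Suc j * p" using assms(1) by simp
  also have "\<dots> \<le> (d + 1) * p" using assms(2) by (intro mult_le_mono1) simp
  finally show ?thesis by (simp add: mult.commute)
qed

lemma coordinate_cases:
  obtains r j where "r < p" "j \<le> d" "i = e (j * p + r)"
proof -
  obtain m where m: "m < p * (d + 1)" "i = e m"
    using bij_e unfolding bij_betw_def by (metis UNIV_I imageE lessThan_iff)
  have "m div p < d + 1" using m by (simp add: less_mult_imp_div_less mult.commute)
  then show ?thesis using m p_pos by (intro that[of "m mod p" "m div p"]) auto
qed

lemma mod_entry_eqI:
  assumes "\<And>r j. r < p \<Longrightarrow> j \<le> d \<Longrightarrow> mod_entry e p g r j = mod_entry e p h r j"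
  shows "g = h"
  unfolding vec_eq_iff
proof
  fix i
  show "g $ i = h $ i"
    by (rule coordinate_cases[of i]) (use assms in \<open>auto simp: mod_entry_def\<close>)
qed

text \<open>A right inverse of \<open>mod_entry\<close>, for building witnesses and perturbation
  directions class by class.\<close>

definition of_classes :: "(nat \<Rightarrow> nat \<Rightarrow> real) \<Rightarrow> real ^ 'n" where
  "of_classes f = (\<chi> i. let m = inv_into {..<p * (d + 1)} e i in f (m mod p) (m div p))"

lemma mod_entry_of_classes [simp]:
  assumes "r < p" "j \<le> d"
  shows "mod_entry e p (of_classes f) r j = f r j"
proof -
  have "inv_into {..<p * (d + 1)} e (e (j * p + r)) = j * p + r"
    using bij_e index_less[OF assms] by (simp add: bij_betw_def)
  then show ?thesis using assms by (simp add: mod_entry_def of_classes_def)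
qed

section \<open>Polynomial form of \<open>L\<close> on a class and its two leading
  coefficients\<close>

lemma L_eq_binomial_sum:
  assumes "r < p"
  shows "L e p d h (t * p + r) = (\<Sum>j=0..d. mod_entry e p h r j * real ((t + d - j) choose d))"
proof -
  define G :: "real fps" where
    "G = Abs_fps (\<lambda>n. if p dvd n then real ((n div p + d) choose d) else 0)"
  define n where "n = t * p + r"
  have "L e p d h n = fps_nth (h_series e p d h * G) n"
    unfolding L_def G_def inverse_one_minus_X_power[OF p_pos, symmetric]
    using p_pos by (subst fps_divide_unit) auto
  also have "\<dots> = (\<Sum>i<p * (d + 1). if n < i then 0 else h $ e i * fps_nth G (n - i))"
    by (simp add: h_series_def sum_distrib_right fps_sum_nth mult.assoc fps_X_power_mult_nth
        if_distrib cong: if_cong)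
  \<comment> \<open>The indices are cut into blocks of length \<open>p\<close>; block
    \<open>j\<close> has exactly one index congruent to \<open>n\<close> modulo \<open>p\<close>,
    namely \<open>j * p + r\<close>.\<close>
  also have "\<dots> = (\<Sum>j<d + 1. \<Sum>i\<in>{j * p..<j * p + p}. if n < i then 0 else h $ e i * fps_nth G (n - i))"
    by (simp add: sum.nat_group mult.commute)
  also have "\<dots> = (\<Sum>j<d + 1. mod_entry e p h r j * real ((t + d - j) choose d))"
  proof (rule sum.cong[OF refl])
    fix j assume "j \<in> {..<d + 1}"
    then have j: "j \<le> d" by simp
    have off: "(if n < i then 0 else h $ e i * fps_nth G (n - i)) = 0"
      if "i \<in> {j * p..<j * p + p}" "i \<noteq> j * p + r" for i
    proof -
      have "\<not> p dvd (n - i)" if "\<not> n < i"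
      proof
        assume "p dvd n - i"
        then have "n mod p = i mod p"
          using that by (metis mod_eq_dvd_iff_nat not_le)
        moreover have "n mod p = r" using assms by (simp add: n_def)
        moreover obtain s where "i = j * p + s" "s < p"
          using \<open>i \<in> {j * p..<j * p + p}\<close>
          by (metis add_less_cancel_left atLeastLessThan_iff le_iff_add)
        ultimately show False using \<open>i \<noteq> j * p + r\<close> by simp
      qed
      then show ?thesis by (simp add: G_def)
    qed
    have "(\<Sum>i\<in>{j * p..<j * p + p}. if n < i then 0 else h $ e i * fps_nth G (n - i)) =
      (\<Sum>i\<in>{j * p + r}. if n < i then 0 else h $ e i * fps_nth G (n - i))"
      using off assms by (intro sum.mono_neutral_right) auto
    also have "\<dots> = mod_entry e p h r j * real ((t + d - j) choose d)"
    proof (cases "t < j")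
      \<comment> \<open>Here the series has no contribution, and the binomial coefficient vanishes
        because \<open>t + d - j < d\<close>.\<close>
      case True
      then have "n < j * p + r" using p_pos by (simp add: n_def)
      moreover have "t + d - j < d" using True j by simp
      ultimately show ?thesis by simp
    next
      case False
      then have "n - (j * p + r) = (t - j) * p" and "\<not> n < j * p + r"
        by (auto simp: n_def diff_mult_distrib)
      then show ?thesis using p_pos False by (simp add: G_def mod_entry_def)
    qed
    finally show "(\<Sum>i\<in>{j * p..<j * p + p}. if n < i then 0 else h $ e i * fps_nth G (n - i)) =
      mod_entry e p h r j * real ((t + d - j) choose d)" .
  qed
  finally show ?thesis unfolding n_def by (simp add: atLeast0AtMost lessThan_Suc_atMost)
qed

text \<open>The successor of class \<open>p - 1\<close> at \<open>t\<close> is class 0 at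
  \<open>t + 1\<close>. The \<open>of_bool\<close> term absorbs this, and the bracketing matches the
  form \<open>t + c\<close> of the limit lemmas.\<close>

lemma L_step_eq:
  assumes "r < p"
  shows "L e p d h (t * p + r + 1) =
    (\<Sum>j=0..d. mod_entry e p h (Suc r mod p) j * real ((t + (of_bool (Suc r = p) + d - j)) choose d))"
proof (cases "Suc r = p")
  case True
  then have "t * p + r + 1 = Suc t * p + 0" by simp
  then show ?thesis using True p_pos by (simp only: L_eq_binomial_sum) (simp add: add.commute cong: sum.cong_simp)
next
  case False
  then have "Suc r < p" using assms by simp
  then show ?thesis using L_eq_binomial_sum[of "Suc r" h t] False by (simp cong: sum.cong_simp)
qed

lemma L_diff_tendsto:
  assumes "r < p"
  shows "(\<lambda>t. (L e p d h (t * p + r + 1) - L e p d h (t * p + r)) / real t ^ d)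
    \<longlonglongrightarrow> (class_sum e p d h (Suc r mod p) - class_sum e p d h r) / fact d"
proof -
  have "(\<lambda>t. (\<Sum>j=0..d. mod_entry e p h (Suc r mod p) j *
        (real ((t + (of_bool (Suc r = p) + d - j)) choose d) / real t ^ d))
      - (\<Sum>j=0..d. mod_entry e p h r j * (real ((t + (d - j)) choose d) / real t ^ d)))
    \<longlonglongrightarrow> (\<Sum>j=0..d. mod_entry e p h (Suc r mod p) j * (1 / fact d))
      - (\<Sum>j=0..d. mod_entry e p h r j * (1 / fact d))"
    by (intro tendsto_intros binomial_over_power_tendsto)
  then show ?thesis
    unfolding L_step_eq[OF assms] L_eq_binomial_sum[OF assms]
    by (simp add: class_sum_def diff_divide_distrib sum_divide_distrib cong: sum.cong_simp)
qed

text \<open>With equal class sums the terms of order \<open>t ^ d\<close> cancel and the next order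
  decides.\<close>

lemma L_diff_tendsto_gap:
  assumes "r < p" and d: "d = Suc m"
    and eq: "class_sum e p d h (Suc r mod p) = class_sum e p d h r"
  shows "(\<lambda>t. (L e p d h (t * p + r + 1) - L e p d h (t * p + r)) / real t ^ m)
    \<longlonglongrightarrow> gap e p d h r / fact m"
proof -
  let ?k = "of_bool (Suc r = p) :: nat"
  \<comment> \<open>Subtracting \<open>t choose d\<close> from every binomial coefficient leaves the
    total unchanged, since the class sums agree, and makes each term converge separately.\<close>
  let ?B = "\<lambda>c t. (real ((t + c) choose d) - real (t choose d)) / real t ^ m"
  have "(\<lambda>t. (\<Sum>j=0..d. mod_entry e p h (Suc r mod p) j * ?B (?k + d - j) t)
      - (\<Sum>j=0..d. mod_entry e p h r j * ?B (d - j) t))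
    \<longlonglongrightarrow> (\<Sum>j=0..d. mod_entry e p h (Suc r mod p) j * (real (?k + d - j) / fact m))
      - (\<Sum>j=0..d. mod_entry e p h r j * (real (d - j) / fact m))"
    unfolding d by (intro tendsto_intros binomial_shift_over_power_tendsto)
  also have "(\<lambda>t. (\<Sum>j=0..d. mod_entry e p h (Suc r mod p) j * ?B (?k + d - j) t)
      - (\<Sum>j=0..d. mod_entry e p h r j * ?B (d - j) t)) =
    (\<lambda>t. (L e p d h (t * p + r + 1) - L e p d h (t * p + r)) / real t ^ m)" (is "?F = ?G")
  proof
    fix t
    have "?F t = ((\<Sum>j=0..d. mod_entry e p h (Suc r mod p) j * real ((t + (?k + d - j)) choose d))
        - class_sum e p d h (Suc r mod p) * real (t choose d)
        - ((\<Sum>j=0..d. mod_entry e p h r j * real ((t + (d - j)) choose d))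
        - class_sum e p d h r * real (t choose d))) / real t ^ m"
      unfolding class_sum_def sum_distrib_right sum_subtractf[symmetric] diff_divide_distrib
        sum_divide_distrib
      by (simp add: algebra_simps)
    also have "\<dots> = ?G t"
      unfolding L_step_eq[OF assms(1)] L_eq_binomial_sum[OF assms(1)] eq
      by (simp cong: sum.cong_simp)
    finally show "?F t = ?G t" .
  qed
  also have "(\<Sum>j=0..d. mod_entry e p h (Suc r mod p) j * (real (?k + d - j) / fact m))
      - (\<Sum>j=0..d. mod_entry e p h r j * (real (d - j) / fact m)) =
     ((real ?k + real d) * class_sum e p d h (Suc r mod p) - CM e p d h (Suc r mod p)
      - (real d * class_sum e p d h r - CM e p d h r)) / fact m"
    unfolding class_sum_def CM_def sum_distrib_left sum_subtractf[symmetric] sum_divide_distrib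
    by (intro sum.cong refl) (auto simp: of_nat_diff field_simps)
  also have "\<dots> = gap e p d h r / fact m"
    using eq by (auto simp: gap_def of_bool_def algebra_simps)
  finally show ?thesis .
qed

section \<open>Description of \<open>S1\<close> by linear conditions\<close>

definition gap_polytope :: "(real ^ 'n) set" where
  "gap_polytope = {h. (\<forall>i. h $ i \<ge> 0) \<and> (\<forall>r<p. class_sum e p d h r = 1) \<and>
    (\<forall>r<p. gap e p d h r \<ge> 0)}"

lemma filterlim_class_index: "filterlim (\<lambda>t. t * p + r) at_top sequentially"
proof (rule filterlim_at_top_mono[OF filterlim_ident])
  show "\<forall>\<^sub>F t in sequentially. t \<le> t * p + r"
    using p_pos by (intro always_eventually) (simp add: trans_le_add1)
qed

text \<open>Nonnegative differences have nonnegative scaled limits. The second limit exists only for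
  \<open>d \<ge> 1\<close>, being a coefficient of \<open>t ^ (d - 1)\<close>.\<close>

lemma C_END_D:
  assumes "h \<in> C_END e p d" "r < p"
  shows "class_sum e p d h (Suc r mod p) \<ge> class_sum e p d h r"
    and "class_sum e p d h (Suc r mod p) = class_sum e p d h r \<Longrightarrow> d \<ge> 1 \<Longrightarrow> gap e p d h r \<ge> 0"
proof -
  obtain N where "\<And>n. n \<ge> N \<Longrightarrow> L e p d h (n + 1) \<ge> L e p d h n"
    using assms(1) by (auto simp: C_END_def C_def)
  moreover have "\<forall>\<^sub>F t in sequentially. t * p + r \<ge> N"
    using filterlim_class_index by (simp add: filterlim_at_top)
  ultimately have ev: "\<forall>\<^sub>F t in sequentially. L e p d h (t * p + r + 1) - L e p d h (t * p + r) \<ge> 0"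
    by (auto elim: eventually_mono)
  have "0 \<le> (class_sum e p d h (Suc r mod p) - class_sum e p d h r) / fact d"
    by (rule tendsto_lowerbound[OF L_diff_tendsto[OF assms(2)]])
       (use ev in \<open>auto elim: eventually_mono\<close>)
  then show "class_sum e p d h (Suc r mod p) \<ge> class_sum e p d h r"
    by (simp add: pos_le_divide_eq)
  assume eq: "class_sum e p d h (Suc r mod p) = class_sum e p d h r" and "d \<ge> 1"
  then obtain m where m: "d = Suc m" by (cases d) auto
  have "0 \<le> gap e p d h r / fact m"
    by (rule tendsto_lowerbound[OF L_diff_tendsto_gap[OF assms(2) m eq]])
       (use ev in \<open>auto elim: eventually_mono\<close>)
  then show "gap e p d h r \<ge> 0" by (simp add: pos_le_divide_eq)
qed

text \<open>The class sums increase weakly around a cycle, so they are all equal.\<close>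

lemma C_END_class_sum_eq:
  assumes "h \<in> C_END e p d" "r < p"
  shows "class_sum e p d h r = class_sum e p d h 0"
proof (rule antisym)
  have step: "class_sum e p d h (s mod p) \<le> class_sum e p d h (Suc s mod p)" for s
    using C_END_D(1)[OF assms(1), of "s mod p"] p_pos by (simp add: mod_Suc_eq)
  have mono: "class_sum e p d h (a mod p) \<le> class_sum e p d h (b mod p)" if "a \<le> b" for a b
    using that by (rule lift_Suc_mono_le[of "\<lambda>s. class_sum e p d h (s mod p)", OF step])
  show "class_sum e p d h r \<le> class_sum e p d h 0"
    using mono[of r p] assms(2) by simp
  show "class_sum e p d h 0 \<le> class_sum e p d h r"
    using mono[of 0 r] assms(2) by simp
qed

lemma C_END_I:
  assumes "\<And>r. r < p \<Longrightarrow> \<forall>\<^sub>F t in sequentially. L e p d h (t * p + r + 1) \<ge> L e p d h (t * p + r)"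
  shows "h \<in> C_END e p d"
proof -
  have "\<forall>\<^sub>F t in sequentially. \<forall>r\<in>{..<p}. L e p d h (t * p + r + 1) \<ge> L e p d h (t * p + r)"
    using assms by (intro eventually_ball_finite) auto
  then obtain T where T: "\<And>t r. t \<ge> T \<Longrightarrow> r < p \<Longrightarrow> L e p d h (t * p + r + 1) \<ge> L e p d h (t * p + r)"
    unfolding eventually_sequentially by auto
  have "L e p d h (n + 1) \<ge> L e p d h n" if "n \<ge> T * p" for n
    using T[of "n div p" "n mod p"] that p_pos by (simp add: less_eq_div_iff_mult_less_eq)
  then show ?thesis by (auto simp: C_END_def C_def)
qed

text \<open>A positive limit makes the differences eventually positive. A zero gap would decide
  nothing at this order; such points are reached through the closure.\<close>

lemma C_END_if_gap_pos:
  assumes "\<And>r. r < p \<Longrightarrow> class_sum e p d h r = 1" "\<And>r. r < p \<Longrightarrow> gap e p d h r > 0" "d \<ge> 1"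
  shows "h \<in> C_END e p d"
proof (rule C_END_I)
  fix r assume r: "r < p"
  obtain m where m: "d = Suc m" using assms(3) by (cases d) auto
  have "(\<lambda>t. (L e p d h (t * p + r + 1) - L e p d h (t * p + r)) / real t ^ m)
    \<longlonglongrightarrow> gap e p d h r / fact m"
    using r p_pos assms(1) by (intro L_diff_tendsto_gap m) auto
  then have "\<forall>\<^sub>F t in sequentially. (L e p d h (t * p + r + 1) - L e p d h (t * p + r)) / real t ^ m > 0"
    by (rule order_tendstoD) (use assms(2) r in simp)
  then show "\<forall>\<^sub>F t in sequentially. L e p d h (t * p + r + 1) \<ge> L e p d h (t * p + r)"
    by eventually_elim (auto simp: zero_less_divide_iff not_less dest: leD)
qed

lemma exists_gap_pos:
  assumes "d \<ge> 1"
  obtains g where "\<And>i. g $ i \<ge> 0" "\<And>r. r < p \<Longrightarrow> class_sum e p d g r = 1"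
    "\<And>r. r < p \<Longrightarrow> gap e p d g r > 0"
proof -
  \<comment> \<open>As centers of mass, these values descend from \<open>p / (p + 1)\<close> to
    \<open>1 / (p + 1)\<close> in steps of \<open>1 / (p + 1)\<close>, which leaves
    \<open>2 / (p + 1)\<close> for the wrap-around gap.\<close>
  define c where "c = (\<lambda>r. 1 - real (Suc r) / real (Suc p))"
  define g where "g = of_classes (\<lambda>r j. if j = 0 then 1 - c r else if j = 1 then c r else 0)"
  have c: "0 \<le> c r" "c r \<le> 1" if "r < p" for r
    using that by (auto simp: c_def)
  have split: "{0..d} = insert 0 (insert 1 {2..d})" using assms by auto
  have sum: "class_sum e p d g r = 1" if "r < p" for r
    using that by (simp add: class_sum_def g_def cong: sum.cong_simp) (simp add: split)
  have CM: "CM e p d g r = c r" if "r < p" for r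
    using that by (simp add: CM_def g_def cong: sum.cong_simp) (simp add: split)
  have "gap e p d g r > 0" if "r < p" for r
  proof (cases "Suc r = p")
    case True
    then have "real (Suc r) / real (Suc p) < 1" "real (Suc 0) / real (Suc p) > 0" by simp_all
    moreover have "gap e p d g r = c r - c 0 + 1"
      using True p_pos that sum[of 0] CM[of 0] CM[of r] by (simp add: gap_def)
    ultimately show ?thesis unfolding c_def by linarith
  next
    case False
    then have "Suc r < p" using that by simp
    then have "gap e p d g r = c r - c (Suc r)" using CM[of "Suc r"] CM[of r] by (simp add: gap_def)
    moreover have "real (Suc r) / real (Suc p) < real (Suc (Suc r)) / real (Suc p)"
      by (intro divide_strict_right_mono) simp_all
    ultimately show ?thesis unfolding c_def by linarith
  qed
  moreover have "g $ i \<ge> 0" for i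
  proof (rule coordinate_cases[of i])
    fix r j assume "r < p" "j \<le> d" "i = e (j * p + r)"
    then have "g $ i = mod_entry e p g r j" by (simp add: mod_entry_def)
    then show ?thesis using \<open>r < p\<close> \<open>j \<le> d\<close> c[of r] by (simp add: g_def)
  qed
  ultimately show ?thesis using sum that by blast
qed

text \<open>The linear conditions are closed and hold on \<open>C_END\<close>. Conversely, moving
  slightly towards a point with positive gaps makes all gaps positive.\<close>

lemma S1_eq_gap_polytope: "S1 e p d = gap_polytope"
proof
  have closure: "closure (C_END e p d) \<subseteq>
    {h. \<forall>r<p. class_sum e p d h r = class_sum e p d h 0 \<and> (d \<ge> 1 \<longrightarrow> gap e p d h r \<ge> 0)}"
  proof (rule closure_minimal)
    show "C_END e p d \<subseteq>
      {h. \<forall>r<p. class_sum e p d h r = class_sum e p d h 0 \<and> (d \<ge> 1 \<longrightarrow> gap e p d h r \<ge> 0)}"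
    proof (intro subsetI CollectI allI impI conjI)
      fix h r assume h: "h \<in> C_END e p d" and r: "r < p"
      show "class_sum e p d h r = class_sum e p d h 0" by (rule C_END_class_sum_eq[OF h r])
      moreover have "class_sum e p d h (Suc r mod p) = class_sum e p d h 0"
        using p_pos by (intro C_END_class_sum_eq[OF h]) simp
      ultimately show "gap e p d h r \<ge> 0" if "d \<ge> 1"
        using C_END_D(2)[OF h r] that by simp
    qed
    show "closed {h. \<forall>r<p. class_sum e p d h r = class_sum e p d h 0 \<and> (d \<ge> 1 \<longrightarrow> gap e p d h r \<ge> 0)}"
      by (intro closed_Collect_all closed_Collect_imp closed_Collect_conj closed_Collect_eq
          closed_Collect_le continuous_on_class_sum continuous_on_gap continuous_on_const
          open_Collect_const)
  qed
  show "S1 e p d \<subseteq> gap_polytope"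
  proof
    fix h assume h: "h \<in> S1 e p d"
    then have "class_sum e p d h 0 = 1" by (simp add: S1_def class_sum_def)
    moreover have clos: "\<forall>r<p. class_sum e p d h r = class_sum e p d h 0 \<and> (d \<ge> 1 \<longrightarrow> gap e p d h r \<ge> 0)"
      using h closure unfolding S1_def by blast
    ultimately have sum: "class_sum e p d h r = 1" if "r < p" for r
      using that by metis
    have "gap e p d h r \<ge> 0" if "r < p" for r
    proof (cases d)
      \<comment> \<open>For \<open>d = 0\<close> all centers of mass vanish, so the gap is
        \<open>of_bool (Suc r = p)\<close>.\<close>
      case 0
      then show ?thesis using sum[of 0] that by (simp add: gap_def CM_def)
    next
      case (Suc m)
      then show ?thesis using clos that by simp
    qed
    then show "h \<in> gap_polytope" using h sum by (auto simp: S1_def gap_polytope_def)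
  qed
  show "gap_polytope \<subseteq> S1 e p d"
  proof
    fix h assume h: "h \<in> gap_polytope"
    have "h \<in> closure (C_END e p d)"
    proof (cases "d \<ge> 1")
      case True
      then obtain g where g: "\<And>r. r < p \<Longrightarrow> class_sum e p d g r = 1"
        "\<And>r. r < p \<Longrightarrow> gap e p d g r > 0" by (rule exists_gap_pos) blast
      define u where "u = (\<lambda>n. h + (1 / real (Suc n)) *\<^sub>R (g - h))"
      have "u \<longlonglongrightarrow> h + 0 *\<^sub>R (g - h)"
        unfolding u_def by (intro tendsto_intros LIMSEQ_Suc[OF lim_1_over_n])
      moreover have "u n \<in> C_END e p d" for n
      proof (rule C_END_if_gap_pos[OF _ _ True])
        fix r assume r: "r < p"
        show "class_sum e p d (u n) r = 1" using h g r by (simp add: u_def gap_polytope_def)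
        have "gap e p d (u n) r =
            (1 - 1 / real (Suc n)) * gap e p d h r + 1 / real (Suc n) * gap e p d g r"
          unfolding u_def by (simp only: gap_linear) (simp add: algebra_simps)
        also have "\<dots> > 0"
          using h g(2)[OF r] r
          by (intro add_nonneg_pos mult_nonneg_nonneg mult_pos_pos) (auto simp: gap_polytope_def)
        finally show "gap e p d (u n) r > 0" .
      qed
      ultimately show ?thesis by (auto simp: closure_sequential)
    next
      case False
      then have "d = 0" by simp
      \<comment> \<open>For \<open>d = 0\<close> every entry equals its class sum 1, so
        \<open>L\<close> is constant.\<close>
      have "h \<in> C_END e p d"
      proof (rule C_END_I)
        fix r assume r: "r < p"
        have "Suc r mod p < p" using p_pos by simp
        then have "mod_entry e p h s 0 = 1" if "s = r \<or> s = Suc r mod p" for s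
        proof -
          have "s < p" using that r \<open>Suc r mod p < p\<close> by auto
          then have "class_sum e p d h s = 1" using h by (simp add: gap_polytope_def)
          then show ?thesis using \<open>d = 0\<close> by (simp add: class_sum_def)
        qed
        then show "\<forall>\<^sub>F t in sequentially. L e p d h (t * p + r + 1) \<ge> L e p d h (t * p + r)"
          unfolding L_step_eq[OF r] L_eq_binomial_sum[OF r] using \<open>d = 0\<close> by simp
      qed
      then show ?thesis using closure_subset by blast
    qed
    then show "h \<in> S1 e p d"
      using h p_pos by (auto simp: S1_def gap_polytope_def class_sum_def)
  qed
qed

section \<open>Entries of points of the polytope\<close>

lemma mod_entry_nonneg: "h \<in> gap_polytope \<Longrightarrow> mod_entry e p h r j \<ge> 0"
  by (simp add: gap_polytope_def mod_entry_def)

lemma mod_entry_eq_0_if_unit: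
  assumes "h \<in> gap_polytope" "r < p" "mod_entry e p h r k = 1" "k \<le> d" "j \<le> d" "j \<noteq> k"
  shows "mod_entry e p h r j = 0"
proof -
  have "1 = mod_entry e p h r k + (\<Sum>j\<in>{0..d} - {k}. mod_entry e p h r j)"
    using assms sum.remove[of "{0..d}" k "mod_entry e p h r"]
    by (simp add: gap_polytope_def class_sum_def)
  then have "(\<Sum>j\<in>{0..d} - {k}. mod_entry e p h r j) = 0" using assms by simp
  then show ?thesis
    using assms by (subst (asm) sum_nonneg_eq_0_iff) (auto intro: mod_entry_nonneg)
qed

lemma mod_entry_le_1:
  assumes "h \<in> gap_polytope" "r < p" "j \<le> d"
  shows "mod_entry e p h r j \<le> 1"
proof -
  have "mod_entry e p h r j \<le> class_sum e p d h r"
    unfolding class_sum_def using assms by (intro member_le_sum) (auto intro: mod_entry_nonneg)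
  then show ?thesis using assms by (simp add: gap_polytope_def)
qed

lemma Max_eq_1_iff:
  assumes "h \<in> gap_polytope"
  shows "Max (range (\<lambda>i. h $ i)) = 1 \<longleftrightarrow> (\<exists>r<p. \<exists>j\<le>d. mod_entry e p h r j = 1)"
proof -
  have "h $ i \<le> 1" for i
    by (rule coordinate_cases[of i]) (use mod_entry_le_1[OF assms] in \<open>auto simp: mod_entry_def\<close>)
  then have "Max (range (\<lambda>i. h $ i)) = 1 \<longleftrightarrow> (\<exists>i. h $ i = 1)"
    by (subst Max_eq_iff) (auto intro: rev_image_eqI)
  also have "\<dots> \<longleftrightarrow> (\<exists>r<p. \<exists>j\<le>d. mod_entry e p h r j = 1)"
    unfolding mod_entry_def by (metis coordinate_cases)
  finally show ?thesis .
qed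

lemma CM_Ints_if_unit:
  assumes "h \<in> gap_polytope" "r < p" "mod_entry e p h r k = 1" "k \<le> d"
  shows "CM e p d h r \<in> \<int>"
proof -
  have "CM e p d h r = (\<Sum>j=0..d. if j = k then real k else 0)"
    unfolding CM_def using mod_entry_eq_0_if_unit[OF assms] assms(3) by (intro sum.cong) auto
  then show ?thesis using assms(4) by simp
qed

section \<open>Vertices satisfy the three conditions\<close>

text \<open>The hypotheses say that \<open>v\<close> preserves every constraint tight at
  \<open>h\<close>; the others have slack. So \<open>h\<close> is the midpoint of two points of the
  polytope on the line along \<open>v\<close>.\<close>

lemma not_extreme_if_perturbation:
  assumes h: "h \<in> gap_polytope" and "v \<noteq> 0"
    and supp: "\<And>r j. r < p \<Longrightarrow> j \<le> d \<Longrightarrow> mod_entry e p h r j = 0 \<Longrightarrow> mod_entry e p v r j = 0"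
    and sum: "\<And>r. r < p \<Longrightarrow> class_sum e p d v r = 0"
    and gap: "\<And>r. r < p \<Longrightarrow> gap e p d h r = 0 \<Longrightarrow> gap e p d v r = 0"
  shows "\<not> h extreme_point_of gap_polytope"
proof -
  have "\<forall>\<^sub>F \<delta> in nhds 0. \<forall>i\<in>UNIV. h $ i + \<delta> * v $ i \<ge> 0"
  proof (intro eventually_ball_finite ballI)
    fix i
    have "h $ i = 0 \<Longrightarrow> v $ i = 0"
      by (rule coordinate_cases[of i]) (use supp in \<open>auto simp: mod_entry_def\<close>)
    then show "\<forall>\<^sub>F \<delta> in nhds 0. h $ i + \<delta> * v $ i \<ge> 0"
      using h by (intro eventually_nonneg_perturbation) (auto simp: gap_polytope_def)
  qed simp
  moreover have "\<forall>\<^sub>F \<delta> in nhds 0. \<forall>r\<in>{..<p}. gap e p d h r + \<delta> * gap e p d v r \<ge> 0"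
    using h gap
    by (intro eventually_ball_finite ballI eventually_nonneg_perturbation) (auto simp: gap_polytope_def)
  ultimately have "\<forall>\<^sub>F \<delta> in nhds 0. h + \<delta> *\<^sub>R v \<in> gap_polytope"
    by eventually_elim (use h sum in \<open>auto simp: gap_polytope_def\<close>)
  then obtain \<epsilon> where "\<epsilon> > 0" and \<epsilon>: "\<And>\<delta>. \<bar>\<delta>\<bar> < \<epsilon> \<Longrightarrow> h + \<delta> *\<^sub>R v \<in> gap_polytope"
    by (auto simp: eventually_nhds_metric dist_real_def)
  define a where "a = h + (- \<epsilon> / 2) *\<^sub>R v"
  define b where "b = h + (\<epsilon> / 2) *\<^sub>R v"
  have "a \<in> gap_polytope" "b \<in> gap_polytope"
    unfolding a_def b_def using \<open>\<epsilon> > 0\<close> by (intro \<epsilon>; simp)+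
  moreover have "b - a = \<epsilon> *\<^sub>R v" by (simp add: a_def b_def flip: scaleR_add_left)
  then have "a \<noteq> b" using \<open>\<epsilon> > 0\<close> \<open>v \<noteq> 0\<close> by auto
  moreover have "h = midpoint a b"
    by (simp add: midpoint_def a_def b_def vec_eq_iff)
  ultimately show ?thesis
    unfolding extreme_point_of_def by (metis midpoint_in_open_segment)
qed

text \<open>Three free weights under two linear conditions, sum and center of mass, leave a nonzero
  direction of motion.\<close>

lemma card_le_2_if_extreme:
  assumes ext: "h extreme_point_of gap_polytope" and r: "r < p"
  shows "card {j \<in> {0..d}. mod_entry e p h r j \<noteq> 0} \<le> 2"
proof (rule ccontr)
  assume "\<not> ?thesis"
  then have "card {j \<in> {0..d}. mod_entry e p h r j \<noteq> 0} \<ge> 3" by simp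
  then obtain T where T: "T \<subseteq> {j \<in> {0..d}. mod_entry e p h r j \<noteq> 0}" "card T = 3"
    by (meson obtain_subset_with_card_n)
  then obtain x y z where xyz: "T = {x, y, z}" "x \<noteq> y" "y \<noteq> z" "x \<noteq> z"
    by (auto simp: card_3_iff)
  then have le: "x \<le> d" "y \<le> d" "z \<le> d"
    and nz: "mod_entry e p h r x \<noteq> 0" "mod_entry e p h r y \<noteq> 0" "mod_entry e p h r z \<noteq> 0"
    using T by auto
  \<comment> \<open>The cross product of \<open>(1, 1, 1)\<close> and \<open>(x, y, z)\<close>,
    hence orthogonal to both.\<close>
  define w where "w = (\<lambda>j. of_bool (j = x) * (real z - real y) + of_bool (j = y) * (real x - real z)
    + of_bool (j = z) * (real y - real x))"
  define v where "v = of_classes (\<lambda>s j. of_bool (s = r) * w j)"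
  have sums: "(\<Sum>j=0..d. f j * w j) =
      f x * (real z - real y) + f y * (real x - real z) + f z * (real y - real x)" for f
  proof -
    have "(\<Sum>j=0..d. f j * w j) = (\<Sum>j=0..d. (if j = x then f x * (real z - real y) else 0)
        + (if j = y then f y * (real x - real z) else 0) + (if j = z then f z * (real y - real x) else 0))"
      using xyz by (intro sum.cong refl) (auto simp: w_def)
    then show ?thesis using le by (simp add: sum.distrib)
  qed
  have sum: "class_sum e p d v s = 0" if "s < p" for s
    using that sums[of "\<lambda>_. 1"] by (cases "s = r") (simp_all add: class_sum_def v_def cong: sum.cong_simp)
  have CM: "CM e p d v s = 0" if "s < p" for s
    using that sums[of real]
    by (cases "s = r") (simp_all add: CM_def v_def right_diff_distrib mult.commute cong: sum.cong_simp)
  have "mod_entry e p v r x \<noteq> 0" using r le xyz by (simp add: v_def w_def)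
  then have "v \<noteq> 0" by (auto simp: mod_entry_def)
  then have "\<not> h extreme_point_of gap_polytope"
  proof (rule not_extreme_if_perturbation[rotated])
    show "h \<in> gap_polytope" using ext by (simp add: extreme_point_of_def)
    show "gap e p d v s = 0" if "s < p" for s
      using that CM sum p_pos by (simp add: gap_def)
    show "mod_entry e p v s j = 0" if "s < p" "j \<le> d" "mod_entry e p h s j = 0" for s j
      using that nz by (auto simp: v_def w_def of_bool_def)
  qed (rule sum)
  then show False using ext by simp
qed

text \<open>Moving the centers of mass of all classes congruent to \<open>CM s\<close> modulo 1 by the same amount
  respects the tight gap inequalities, because these only relate congruent centers of mass. It is
  impossible only if one of these classes is concentrated in a single entry.\<close>

lemma exists_unit_if_extreme:
  assumes ext: "h extreme_point_of gap_polytope" and s: "s < p"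
  shows "\<exists>r<p. CM e p d h r - CM e p d h s \<in> \<int> \<and> (\<exists>j\<le>d. mod_entry e p h r j = 1)"
proof (rule ccontr)
  assume none: "\<not> ?thesis"
  have h: "h \<in> gap_polytope" using ext by (simp add: extreme_point_of_def)
  define R where "R = {r. r < p \<and> CM e p d h r - CM e p d h s \<in> \<int>}"
  \<comment> \<open>A class with sum 1 and no entry 1 has at least two nonzero entries.\<close>
  have "\<exists>x y. x \<le> d \<and> y \<le> d \<and> x \<noteq> y \<and> mod_entry e p h r x \<noteq> 0 \<and> mod_entry e p h r y \<noteq> 0"
    if r: "r \<in> R" for r
  proof -
    have total: "(\<Sum>j=0..d. mod_entry e p h r j) = 1"
      using h r by (simp add: R_def gap_polytope_def class_sum_def)
    then obtain x where x: "x \<le> d" "mod_entry e p h r x \<noteq> 0"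
      by (metis atLeastAtMost_iff sum.neutral zero_neq_one)
    have "mod_entry e p h r x \<noteq> 1" using none r x by (auto simp: R_def)
    moreover have "1 = mod_entry e p h r x + (\<Sum>j\<in>{0..d} - {x}. mod_entry e p h r j)"
      using total x sum.remove[of "{0..d}" x "mod_entry e p h r"] by simp
    ultimately have "(\<Sum>j\<in>{0..d} - {x}. mod_entry e p h r j) \<noteq> 0" by auto
    then obtain y where "y \<in> {0..d} - {x}" "mod_entry e p h r y \<noteq> 0"
      by (meson sum.neutral)
    then show ?thesis using x by auto
  qed
  then obtain a b where ab: "\<And>r. r \<in> R \<Longrightarrow> a r \<le> d \<and> b r \<le> d \<and> a r \<noteq> b r \<and>
      mod_entry e p h r (a r) \<noteq> 0 \<and> mod_entry e p h r (b r) \<noteq> 0"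
    by metis
  \<comment> \<open>Weight moves from \<open>a r\<close> to \<open>b r\<close>, scaled by their
    signed distance so that each center of mass in \<open>R\<close> grows by exactly 1.\<close>
  define v where "v = of_classes (\<lambda>r j. of_bool (r \<in> R) *
    ((of_bool (j = b r) - of_bool (j = a r)) / (real (b r) - real (a r))))"
  have sums: "(\<Sum>j=0..d. f j * mod_entry e p v r j) =
      of_bool (r \<in> R) * (f (b r) - f (a r)) / (real (b r) - real (a r))" if "r < p" for f r
  proof -
    have "(\<Sum>j=0..d. f j * mod_entry e p v r j) = (\<Sum>j=0..d. of_bool (r \<in> R) *
        ((if j = b r then f (b r) else 0) - (if j = a r then f (a r) else 0)) / (real (b r) - real (a r)))"
      using that by (intro sum.cong refl) (auto simp: v_def)
    also have "\<dots> = of_bool (r \<in> R) * (f (b r) - f (a r)) / (real (b r) - real (a r))"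
      using ab[of r] by (cases "r \<in> R") (auto simp: sum_subtractf simp flip: sum_divide_distrib)
    finally show ?thesis .
  qed
  have sum: "class_sum e p d v r = 0" if "r < p" for r
    using sums[OF that, of "\<lambda>_. 1"] by (simp add: class_sum_def)
  have CM: "CM e p d v r = of_bool (r \<in> R)" if "r < p" for r
    using sums[OF that, of real] ab[of r] by (auto simp: CM_def)
  have "s \<in> R" using s by (simp add: R_def)
  then have "v \<noteq> 0" using CM[OF s] by (auto simp: CM_def mod_entry_def)
  then have "\<not> h extreme_point_of gap_polytope"
  proof (rule not_extreme_if_perturbation[OF h])
    fix r assume r: "r < p" and tight: "gap e p d h r = 0"
    have r': "Suc r mod p < p" using p_pos by simp
    have "CM e p d h (Suc r mod p) = CM e p d h r + of_bool (Suc r = p)"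
      using tight h p_pos by (simp add: gap_def gap_polytope_def)
    then have "CM e p d h (Suc r mod p) - CM e p d h s =
        (CM e p d h r - CM e p d h s) + of_int (of_bool (Suc r = p))" by simp
    \<comment> \<open>A tight gap links centers of mass differing by 0 or 1, so both classes lie in
      \<open>R\<close> or neither does.\<close>
    then have "Suc r mod p \<in> R \<longleftrightarrow> r \<in> R"
      using r r' by (simp only: R_def mem_Collect_eq) simp
    then show "gap e p d v r = 0"
      using CM r r' sum p_pos by (simp add: gap_def)
  next
    show "mod_entry e p v r j = 0" if "r < p" "j \<le> d" "mod_entry e p h r j = 0" for r j
      using that ab[of r] by (auto simp: v_def of_bool_def)
  qed (rule sum)
  then show False using ext by simp
qed

section \<open>The three conditions imply extremality\<close>

text \<open>The centers of mass cancel around the cycle; only the wrap-around term remains.\<close>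

lemma sum_gap:
  assumes "h \<in> gap_polytope"
  shows "(\<Sum>r<p. gap e p d h r) = 1"
proof -
  obtain q where q: "p = Suc q" using p_pos by (cases p) auto
  have "(\<Sum>r<p. CM e p d h (Suc r mod p)) = (\<Sum>r<q. CM e p d h (Suc r)) + CM e p d h 0"
    by (simp add: q)
  also have "\<dots> = (\<Sum>r<p. CM e p d h r)"
    unfolding q by (subst sum.lessThan_Suc_shift) simp
  finally have "(\<Sum>r<p. CM e p d h (Suc r mod p)) = (\<Sum>r<p. CM e p d h r)" .
  moreover have "class_sum e p d h 0 = 1" using assms p_pos by (simp add: gap_polytope_def)
  then have "(\<Sum>r<p. of_bool (Suc r = p) * class_sum e p d h 0) = 1"
    by (simp only:) (simp add: q of_bool_def)
  ultimately show ?thesis by (simp add: gap_def sum.distrib sum_subtractf)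
qed

text \<open>Integral centers of mass make the gaps nonnegative integers with sum 1.\<close>

lemma exists_only_positive_gap:
  assumes h: "h \<in> gap_polytope" and int: "\<And>r. r < p \<Longrightarrow> CM e p d h r \<in> \<int>"
  obtains m where "m < p" "\<And>r. r < p \<Longrightarrow> r \<noteq> m \<Longrightarrow> gap e p d h r = 0"
proof -
  have nonneg: "gap e p d h r \<ge> 0" if "r < p" for r using h that by (simp add: gap_polytope_def)
  have ge: "gap e p d h r \<ge> 1" if "r < p" "gap e p d h r \<noteq> 0" for r
  proof -
    have "gap e p d h r = CM e p d h r - CM e p d h (Suc r mod p) + of_int (of_bool (Suc r = p))"
      using h p_pos by (simp add: gap_def gap_polytope_def)
    then have "gap e p d h r \<in> \<int>" using int that p_pos by simp
    then show ?thesis using nonneg[OF that(1)] that(2) by (auto elim!: Ints_cases)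
  qed
  obtain m where m: "m < p" "gap e p d h m \<noteq> 0"
    using sum_gap[OF h] by (metis lessThan_iff sum.neutral zero_neq_one)
  have "gap e p d h r = 0" if r: "r < p" "r \<noteq> m" for r
  proof (rule ccontr)
    assume "gap e p d h r \<noteq> 0"
    then have "2 \<le> (\<Sum>r\<in>{r, m}. gap e p d h r)" using ge[of r] ge[of m] m r by simp
    also have "\<dots> \<le> (\<Sum>r<p. gap e p d h r)" using m r nonneg by (intro sum_mono2) auto
    finally show False using sum_gap[OF h] by simp
  qed
  then show ?thesis using that m by blast
qed

text \<open>For a segment through \<open>h\<close>, its direction \<open>v\<close> preserves the
  tight constraints. The tight gaps give all classes the same shift of center of mass, the unit
  entry makes it 0, and two moments then determine each class.\<close>

lemma extreme_if_integral:
  assumes h: "h \<in> gap_polytope"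
    and unit: "r0 < p" "k \<le> d" "mod_entry e p h r0 k = 1"
    and card: "\<And>r. r < p \<Longrightarrow> card {j \<in> {0..d}. mod_entry e p h r j \<noteq> 0} \<le> 2"
    and int: "\<And>r. r < p \<Longrightarrow> CM e p d h r \<in> \<int>"
  shows "h extreme_point_of gap_polytope"
  unfolding extreme_point_of_def
proof (intro conjI ballI notI h)
  fix a b assume a: "a \<in> gap_polytope" and b: "b \<in> gap_polytope" and "h \<in> open_segment a b"
  then obtain u where "a \<noteq> b" and u: "0 < u" "u < 1" "h = (1 - u) *\<^sub>R a + u *\<^sub>R b"
    by (auto simp: in_segment)
  \<comment> \<open>Transfers each constraint tight at \<open>h\<close> to both endpoints.\<close>
  have zero: "x = 0 \<and> y = 0" if "(1 - u) * x + u * y = 0" "x \<ge> 0" "y \<ge> 0" for x y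
    using that u by (simp add: add_nonneg_eq_0_iff)
  define v where "v = b - a"
  have supp: "mod_entry e p v r j = 0" if "mod_entry e p h r j = 0" for r j
    using that zero[of "mod_entry e p a r j" "mod_entry e p b r j"] mod_entry_nonneg a b
    by (simp add: v_def u(3))
  have sum: "class_sum e p d v r = 0" if "r < p" for r
    using that a b by (simp add: v_def gap_polytope_def)
  have tight: "CM e p d v (Suc r mod p) = CM e p d v r" if "r < p" "gap e p d h r = 0" for r
  proof -
    have "gap e p d a r = 0 \<and> gap e p d b r = 0"
      using that a b by (intro zero) (auto simp: u(3) gap_polytope_def)
    then have "gap e p d v r = 0" by (simp add: v_def)
    then show ?thesis using sum[of 0] p_pos by (simp add: gap_def)
  qed
  obtain m where "m < p" and m: "\<And>r. r < p \<Longrightarrow> r \<noteq> m \<Longrightarrow> gap e p d h r = 0"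
    using exists_only_positive_gap[OF h int] by blast
  \<comment> \<open>The cycle is cut at \<open>m\<close>: classes up to \<open>m\<close> are linked
    upwards from 0, later ones downwards from \<open>p\<close>, which is class 0 again.\<close>
  have const: "CM e p d v r = CM e p d v 0" if "r < p" for r
  proof (cases "r \<le> m")
    case True
    then show ?thesis
    proof (induction r)
      case (Suc r)
      then show ?case using tight[OF _ m, of r] \<open>m < p\<close> by simp
    qed simp
  next
    case False
    have "r \<le> p" using that by simp
    then have "m < r \<Longrightarrow> CM e p d v (r mod p) = CM e p d v 0"
    proof (induction rule: inc_induct)
      case (step n)
      then show ?case using tight[OF _ m, of n] by simp
    qed simp
    then show ?thesis using False that by simp
  qed
  have supp_sum: "(\<Sum>j\<in>{j \<in> {0..d}. mod_entry e p h r j \<noteq> 0}. f j * mod_entry e p v r j) =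
      (\<Sum>j=0..d. f j * mod_entry e p v r j)" for r and f :: "nat \<Rightarrow> real"
    by (rule sum.mono_neutral_left) (auto simp: supp)
  have off: "mod_entry e p v r0 j = 0" if "j \<le> d" "j \<noteq> k" for j
    using mod_entry_eq_0_if_unit[OF h unit(1,3,2) that] by (rule supp)
  then have "(\<Sum>j\<in>{k}. mod_entry e p v r0 j) = class_sum e p d v r0"
    unfolding class_sum_def using unit(2) by (intro sum.mono_neutral_left) auto
  \<comment> \<open>Outside \<open>k\<close> the support condition applies; at \<open>k\<close> the
    zero class sum does.\<close>
  then have "mod_entry e p v r0 j = 0" if "j \<le> d" for j
    using that sum[OF unit(1)] off by (cases "j = k") auto
  then have "CM e p d v r0 = 0" by (simp add: CM_def)
  then have CM: "CM e p d v r = 0" if "r < p" for r using const[OF that] const[OF unit(1)] by simp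
  have "mod_entry e p v r j = 0" if "r < p" "j \<le> d" for r j
  proof (cases "mod_entry e p h r j = 0")
    case False
    show ?thesis
      by (rule weights_eq_0_if_two_moments_eq_0[OF _ card[OF that(1)]])
        (use False that sum CM supp_sum[where f = real] supp_sum[where f = "\<lambda>_. 1"] in
          \<open>simp_all add: class_sum_def CM_def\<close>)
  qed (rule supp)
  then have "v = 0" by (intro mod_entry_eqI) (simp add: mod_entry_def)
  then show False using \<open>a \<noteq> b\<close> by (simp add: v_def)
qed

end

theorem theorem5p3:
  fixes p d :: nat and e :: "nat \<Rightarrow> 'n::finite" and h :: "real ^ 'n"
  assumes "p \<ge> 1"
    and "bij_betw e {..<p * (d + 1)} UNIV"
    and "h \<in> S1 e p d"
  shows "h extreme_point_of S1 e p d \<longleftrightarrow>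
    Max (range (\<lambda>i. h $ i)) = 1 \<and>
    (\<forall>r<p. card {j \<in> {0..d}. mod_entry e p h r j \<noteq> 0} \<le> 2) \<and>
    (\<forall>r<p. CM e p d h r \<in> \<int>)"
proof -
  interpret mod_classes p d e using assms by unfold_locales
  have h: "h \<in> gap_polytope" using assms(3) by (simp add: S1_eq_gap_polytope)
  show ?thesis
    unfolding S1_eq_gap_polytope Max_eq_1_iff[OF h]
  proof (intro iffI conjI allI impI)
    assume ext: "h extreme_point_of gap_polytope"
    show "\<exists>r<p. \<exists>j\<le>d. mod_entry e p h r j = 1"
      using exists_unit_if_extreme[OF ext, of 0] p_pos by auto
    show "card {j \<in> {0..d}. mod_entry e p h r j \<noteq> 0} \<le> 2" if "r < p" for r
      using card_le_2_if_extreme[OF ext that] .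
    \<comment> \<open>Some class with a unit entry has a center of mass congruent to that of
      \<open>r\<close> modulo 1, and its own is an integer.\<close>
    show "CM e p d h r \<in> \<int>" if r: "r < p" for r
    proof -
      obtain s j where s: "s < p" "CM e p d h s - CM e p d h r \<in> \<int>" "j \<le> d" "mod_entry e p h s j = 1"
        using exists_unit_if_extreme[OF ext r] by auto
      have "CM e p d h s - (CM e p d h s - CM e p d h r) \<in> \<int>"
        by (rule Ints_diff[OF CM_Ints_if_unit[OF h s(1,4,3)] s(2)])
      then show ?thesis by simp
    qed
  next
    assume "(\<exists>r<p. \<exists>j\<le>d. mod_entry e p h r j = 1) \<and>
      (\<forall>r<p. card {j \<in> {0..d}. mod_entry e p h r j \<noteq> 0} \<le> 2) \<and> (\<forall>r<p. CM e p d h r \<in> \<int>)"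
    then show "h extreme_point_of gap_polytope"
      using extreme_if_integral[OF h] by blast
  qed
qed

end
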